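(* (Direct part.) Let $\nu$ be a non-degenerate compactly supported probability measure on $\mathbb{R}$ with $\int x\,\nu(dx)=m_0$, and let $\{P_\theta:\theta\in\Theta\}$ be the Cauchy-Stieltjes family generated by $\nu$, with $m(\theta)$, its local inverse $\psi$ near $m_0$, and the variance function $V$ as defined in the context. Then there is a neighborhood $(A,B)$ of $m_0$ in which the variance function $V$ is analytic, strictly positive, and $$P_{\psi(m)}(dx)=\frac{V(m)}{V(m)+(m-m_0)(m-x)}\,\nu(dx),\qquad m\in(A,B).$$ (Converse part.) Conversely, let $m_0\in\mathbb{R}$, let $V$ be a real-valued function that is analytic and strictly positive in a neighborhood of $m_0$, and suppose there is a probability measure $\nu$ on $\mathbb{R}$ with mean $m_0$ such that the (positive) measures $$Q_m(dx)=\frac{V(m)}{V(m)+(m-m_0)(m-x)}\,\nu(dx)$$ are probability measures for all $m$ in a neighborhood of $m_0$. Then $\nu$ is compactly supported and non-degenerate, and $\nu$ is determined uniquely by its Cauchy-Stieltjes transform $G_\nu$, which satisfies $$G_\nu(z)=\frac{m-m_0}{V(m)}\qquad\text{with}\qquad z=\frac{1}{\psi(m)}=m+\frac{V(m)}{m-m_0}$$ for all $m\neq m_0$ sufficiently close to $m_0$. In particular, in a perhaps smaller neighborhood $R$ of $m_0$, the probability measures $Q_m$, $m\in R$, are included in the Cauchy-Stieltjes family $\{P_{\psi(m)}: m\in R\}$ generated by $\nu$ (parameterized by the mean).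
   Context: A probability measure is non-degenerate if it is not a point mass. For a non-degenerate compactly supported probability measure $\nu$ on $\mathbb{R}$ with mean $m_0$, put $M(\theta)=\int\frac{1}{1-\theta x}\,\nu(dx)$. The Cauchy-Stieltjes family generated by $\nu$ is the family of probability measures $$P_\theta(dx)=\frac{1}{M(\theta)(1-\theta x)}\,\nu(dx),\qquad \theta\in\Theta,$$ where $\Theta=(-\varepsilon,\varepsilon)$ with $\varepsilon>0$ small enough that, for $\theta\in\Theta$, $M(\theta)$ is well defined and strictly positive and $\theta\,\mathrm{supp}(\nu)\subset(-\infty,1)$. Let $m(\theta)=\int x\,P_\theta(dx)$, so $m(0)=m_0$. The function $\theta\mapsto m(\theta)$ is analytic and increasing on an open interval containing $0$; $\psi$ denotes its inverse function, defined on a neighborhood of $m_0$. The family parameterized by the mean is $\{P_{\psi(m)}\}$ for $m$ in a neighborhood of $m_0$, and its variance function is $V(m)=\int (x-m)^2\,P_{\psi(m)}(dx)$. The Cauchy-Stieltjes transform of a probability measure $\nu$ is $G_\nu(z)=\int\frac{1}{z-x}\,\nu(dx)$; for compactly supported $\nu$ it is analytic near $\infty$. *)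

theory Defs
  imports "HOL-Probability.Probability"
begin

section \<open>Measures on the real line\<close>

definition msupport :: "real measure \<Rightarrow> real set" where
  "msupport \<nu> = {x. \<forall>U. open U \<and> x \<in> U \<longrightarrow> emeasure \<nu> U > 0}"

definition compactly_supported :: "real measure \<Rightarrow> bool" where
  "compactly_supported \<nu> \<longleftrightarrow> compact (msupport \<nu>)"

definition non_degenerate :: "real measure \<Rightarrow> bool" where
  "non_degenerate \<nu> \<longleftrightarrow> (\<forall>c. \<nu> \<noteq> return borel c)"

definition cauchy_stieltjes :: "real measure \<Rightarrow> complex \<Rightarrow> complex" where
  "cauchy_stieltjes \<nu> z = (LINT x|\<nu>. 1 / (z - complex_of_real x))"

text \<open>Real analyticity on an open set: local representability by a power series.\<close>

definition real_analytic_on :: "(real \<Rightarrow> real) \<Rightarrow> real set \<Rightarrow> bool" where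
  "real_analytic_on f S \<longleftrightarrow>
     (\<forall>x\<in>S. \<exists>a r. r > 0 \<and> (\<forall>y. \<bar>y - x\<bar> < r \<longrightarrow> (\<lambda>n. a n * (y - x) ^ n) sums f y))"


section \<open>Cauchy-Stieltjes families\<close>

definition cs_M :: "real measure \<Rightarrow> real \<Rightarrow> real" where
  "cs_M \<nu> \<theta> = (LINT x|\<nu>. 1 / (1 - \<theta> * x))"

text \<open>The radius \<open>\<epsilon>\<close> is small enough for the parameter set \<open>\<Theta> = (-\<epsilon>, \<epsilon>)\<close>.\<close>

definition cs_radius :: "real measure \<Rightarrow> real \<Rightarrow> bool" where
  "cs_radius \<nu> \<epsilon> \<longleftrightarrow> \<epsilon> > 0 \<and>
     (\<forall>\<theta>\<in>{-\<epsilon><..<\<epsilon>}. integrable \<nu> (\<lambda>x. 1 / (1 - \<theta> * x)) \<and> cs_M \<nu> \<theta> > 0 \<and>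
        (\<forall>x\<in>msupport \<nu>. \<theta> * x < 1))"

definition cs_P :: "real measure \<Rightarrow> real \<Rightarrow> real measure" where
  "cs_P \<nu> \<theta> = density \<nu> (\<lambda>x. ennreal (1 / (cs_M \<nu> \<theta> * (1 - \<theta> * x))))"

definition cs_mean :: "real measure \<Rightarrow> real \<Rightarrow> real" where
  "cs_mean \<nu> \<theta> = (LINT x|cs_P \<nu> \<theta>. x)"

text \<open>The inverse \<open>\<psi>\<close> of \<open>\<theta> \<mapsto> m(\<theta>)\<close>. Lemma \<open>strict_mono_on_cs_mean\<close> below shows that the mean
  is strictly increasing on all of \<open>\<Theta>\<close>, so that one can invert on \<open>\<Theta>\<close> itself; any inverse on a
  smaller interval around \<open>0\<close> is a restriction of this one. The value at \<open>m\<close> is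
  meaningful only for \<open>m \<in> cs_mean \<nu> ` \<Theta>\<close>.\<close>

definition cs_psi :: "real measure \<Rightarrow> real \<Rightarrow> real \<Rightarrow> real" where
  "cs_psi \<nu> \<epsilon> = the_inv_into {-\<epsilon><..<\<epsilon>} (cs_mean \<nu>)"

definition cs_variance :: "real measure \<Rightarrow> real \<Rightarrow> real \<Rightarrow> real" where
  "cs_variance \<nu> \<epsilon> m = (LINT x|cs_P \<nu> (cs_psi \<nu> \<epsilon> m). (x - m)\<^sup>2)"

text \<open>The coercion \<open>ennreal\<close> truncates negative values to \<open>0\<close>, and division by \<open>0\<close> yields
  \<open>0\<close>. A hypothesis that \<open>cs_Q \<nu> m0 V m\<close> is a positive measure with the displayed density must
  therefore be accompanied by almost sure positivity of the denominator (for \<open>V m > 0\<close>); this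
  is \<open>cs_Q_prob\<close>.\<close>

definition cs_Q :: "real measure \<Rightarrow> real \<Rightarrow> (real \<Rightarrow> real) \<Rightarrow> real \<Rightarrow> real measure" where
  "cs_Q \<nu> m0 V m = density \<nu> (\<lambda>x. ennreal (V m / (V m + (m - m0) * (m - x))))"

definition cs_Q_prob :: "real measure \<Rightarrow> real \<Rightarrow> (real \<Rightarrow> real) \<Rightarrow> real \<Rightarrow> bool" where
  "cs_Q_prob \<nu> m0 V m \<longleftrightarrow>
     (AE x in \<nu>. V m + (m - m0) * (m - x) > 0) \<and> prob_space (cs_Q \<nu> m0 V m)"


section \<open>Well-definedness\<close>

lemma AE_in_msupport:
  assumes "real_distribution \<nu>"
  shows "AE x in \<nu>. x \<in> msupport \<nu>"
proof -
  interpret real_distribution \<nu> by fact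
  define F where "F = {U. open U \<and> emeasure \<nu> U = 0}"
  obtain F' where F': "F' \<subseteq> F" "countable F'" "\<Union>F' = \<Union>F"
    by (rule Lindelof[of F]) (auto simp: F_def)
  have "\<Union>F' \<in> null_sets \<nu>"
    using F' by (intro null_sets_UN'[of F' "\<lambda>x. x", simplified]) (auto simp: F_def null_sets_def)
  moreover have "- msupport \<nu> = \<Union>F"
    by (auto simp: msupport_def F_def)
  ultimately show ?thesis
    using F'(3) by (intro AE_I'[of "\<Union>F'"]) auto
qed

lemma integrable_continuous_on_msupport:
  fixes f :: "real \<Rightarrow> real"
  assumes "real_distribution \<nu>" "compactly_supported \<nu>"
    and "continuous_on (msupport \<nu>) f" "f \<in> borel_measurable borel"
  shows "integrable \<nu> f"
proof -
  interpret real_distribution \<nu> by fact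
  have "compact (f ` msupport \<nu>)"
    using assms(2,3) by (simp add: compactly_supported_def compact_continuous_image)
  then obtain B where B: "\<forall>y\<in>f ` msupport \<nu>. norm y \<le> B"
    by (meson bounded_iff compact_imp_bounded)
  have "AE x in \<nu>. norm (f x) \<le> B"
    using AE_in_msupport[OF assms(1)] B by auto
  moreover have "f \<in> borel_measurable \<nu>" using assms(4) by simp
  ultimately show ?thesis by (rule integrable_const_bound)
qed

lemma cs_M_pos:
  assumes "real_distribution \<nu>" "integrable \<nu> (\<lambda>x. 1 / (1 - \<theta> * x))"
    and "\<forall>x\<in>msupport \<nu>. \<theta> * x < 1"
  shows "cs_M \<nu> \<theta> > 0"
proof -
  interpret real_distribution \<nu> by fact
  have pos: "AE x in \<nu>. 1 / (1 - \<theta> * x) > 0"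
    using AE_in_msupport[OF assms(1)] assms(3) by auto
  have "(LINT x|\<nu>. 0) < (LINT x|\<nu>. 1 / (1 - \<theta> * x))"
    using pos assms(2) emeasure_space_1 by (intro integral_less_AE_space) (auto simp del: space_eq_univ)
  then show ?thesis by (simp add: cs_M_def)
qed

lemma ex_cs_radius:
  assumes "real_distribution \<nu>" "compactly_supported \<nu>"
  shows "\<exists>\<epsilon>. cs_radius \<nu> \<epsilon>"
proof -
  obtain K where K: "\<forall>x\<in>msupport \<nu>. \<bar>x\<bar> \<le> K" "K > 0"
    using assms(2) unfolding compactly_supported_def
    by (metis bounded_pos compact_imp_bounded real_norm_def)
  have lt: "\<theta> * x < 1" if "\<theta> \<in> {-(1/K)<..<1/K}" "x \<in> msupport \<nu>" for \<theta> x
  proof -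
    have "\<bar>\<theta>\<bar> * \<bar>x\<bar> \<le> \<bar>\<theta>\<bar> * K" using K that by (intro mult_left_mono) auto
    also have "\<dots> < 1" using that(1) K(2) by (auto simp: abs_if field_simps split: if_splits)
    finally show ?thesis by (metis abs_ge_self abs_mult le_less_trans)
  qed
  have int: "integrable \<nu> (\<lambda>x. 1 / (1 - \<theta> * x))" if "\<theta> \<in> {-(1/K)<..<1/K}" for \<theta>
    using lt[OF that] assms
    by (intro integrable_continuous_on_msupport continuous_intros) force+
  have "cs_radius \<nu> (1/K)"
    unfolding cs_radius_def using K(2) lt int cs_M_pos[OF assms(1)] by auto
  then show ?thesis ..
qed

lemma cs_mean_eq:
  assumes "real_distribution \<nu>" "cs_radius \<nu> \<epsilon>" "\<theta> \<in> {-\<epsilon><..<\<epsilon>}"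
  shows "cs_mean \<nu> \<theta> = (LINT x|\<nu>. x / (1 - \<theta> * x)) / cs_M \<nu> \<theta>"
proof -
  interpret real_distribution \<nu> by fact
  have "AE x in \<nu>. 0 \<le> 1 / (cs_M \<nu> \<theta> * (1 - \<theta> * x))"
    using AE_in_msupport[OF assms(1)]
  proof eventually_elim
    case (elim x)
    then have "cs_M \<nu> \<theta> > 0" "\<theta> * x < 1"
      using assms(2,3) by (auto simp: cs_radius_def)
    then show ?case by simp
  qed
  then have "cs_mean \<nu> \<theta> = (LINT x|\<nu>. (1 / (cs_M \<nu> \<theta> * (1 - \<theta> * x))) *\<^sub>R x)"
    unfolding cs_mean_def cs_P_def by (intro integral_density) auto
  also have "\<dots> = (LINT x|\<nu>. (x / (1 - \<theta> * x)) / cs_M \<nu> \<theta>)"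
    by (intro Bochner_Integration.integral_cong) (auto simp: mult.commute)
  also have "\<dots> = (LINT x|\<nu>. x / (1 - \<theta> * x)) / cs_M \<nu> \<theta>"
    by (rule integral_divide_zero)
  finally show ?thesis .
qed

lemma strict_mono_on_cs_mean:
  assumes \<nu>: "real_distribution \<nu>" "compactly_supported \<nu>" "non_degenerate \<nu>"
    and \<epsilon>: "cs_radius \<nu> \<epsilon>"
  shows "strict_mono_on {-\<epsilon><..<\<epsilon>} (cs_mean \<nu>)"
proof (rule strict_mono_onI)
  interpret real_distribution \<nu> by fact
  fix s t assume s: "s \<in> {-\<epsilon><..<\<epsilon>}" and t: "t \<in> {-\<epsilon><..<\<epsilon>}" and "s < t"
  define a where "a = (\<lambda>x::real. 1 / (1 - s * x))"
  define b where "b = (\<lambda>x::real. 1 / (1 - t * x))"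
  define m where "m = cs_mean \<nu> s"
  have pos: "1 - s * x > 0" "1 - t * x > 0" if "x \<in> msupport \<nu>" for x
    using \<epsilon> s t that by (auto simp: cs_radius_def)
  have pos': "AE x in \<nu>. 1 - s * x > 0 \<and> 1 - t * x > 0"
    using AE_in_msupport[OF \<nu>(1)] pos by auto
  have cont: "continuous_on (msupport \<nu>) a" "continuous_on (msupport \<nu>) b"
    unfolding a_def b_def using pos by (auto intro!: continuous_intros) force+
  have [measurable]: "a \<in> borel_measurable borel" "b \<in> borel_measurable borel"
    unfolding a_def b_def by measurable
  have int [simp]: "integrable \<nu> a" "integrable \<nu> b"
    "integrable \<nu> (\<lambda>x. x * a x)" "integrable \<nu> (\<lambda>x. x * b x)"
    "integrable \<nu> (\<lambda>x. (x - m)\<^sup>2 * a x * b x)"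
    by (auto intro!: integrable_continuous_on_msupport[OF \<nu>(1,2)] continuous_intros cont)
  have Ma: "cs_M \<nu> s = integral\<^sup>L \<nu> a" "cs_M \<nu> t = integral\<^sup>L \<nu> b"
    by (simp_all add: cs_M_def a_def b_def)
  have Mpos: "integral\<^sup>L \<nu> a > 0" "integral\<^sup>L \<nu> b > 0"
    using \<epsilon> s t by (auto simp: cs_radius_def simp flip: Ma)
  have ms: "m * integral\<^sup>L \<nu> a = (LINT x|\<nu>. x * a x)"
    using Mpos cs_mean_eq[OF \<nu>(1) \<epsilon> s] by (simp add: m_def Ma a_def)
  have mt: "cs_mean \<nu> t * integral\<^sup>L \<nu> b = (LINT x|\<nu>. x * b x)"
    using Mpos cs_mean_eq[OF \<nu>(1) \<epsilon> t] by (simp add: Ma b_def)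
  have tm: "1 - t * m > 0"
  proof -
    have "(LINT x|\<nu>. 0) < (LINT x|\<nu>. a x - t * (x * a x))"
    proof (rule integral_less_AE_space)
      show "AE x in \<nu>. 0 < a x - t * (x * a x)"
        using pos'
      proof eventually_elim
        case (elim x)
        have "a x - t * (x * a x) = (1 - t * x) * a x" by (simp add: algebra_simps)
        then show ?case using elim by (simp add: a_def)
      qed
    qed (use emeasure_space_1 in \<open>auto simp del: space_eq_univ\<close>)
    also have "\<dots> = integral\<^sup>L \<nu> a - t * (m * integral\<^sup>L \<nu> a)"
      by (simp add: ms)
    also have "\<dots> = (1 - t * m) * integral\<^sup>L \<nu> a" by (simp add: algebra_simps)
    finally show ?thesis using Mpos by (simp add: zero_less_mult_iff)
  qed
  have nz: "(LINT x|\<nu>. (x - m)\<^sup>2 * a x * b x) > 0"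
  proof (rule ccontr)
    assume neg: "\<not> ?thesis"
    have nn: "AE x in \<nu>. 0 \<le> (x - m)\<^sup>2 * a x * b x"
      using pos' by eventually_elim (auto simp: a_def b_def)
    then have "(LINT x|\<nu>. (x - m)\<^sup>2 * a x * b x) = 0"
      using neg integral_nonneg_AE[OF nn] by linarith
    then have "AE x in \<nu>. (x - m)\<^sup>2 * a x * b x = 0"
      using integral_nonneg_eq_0_iff_AE[OF int(5) nn] by simp
    then have AEm: "AE x in \<nu>. x = m"
      using pos' by eventually_elim (auto simp: a_def b_def)
    have "\<nu> = return borel m"
    proof (rule measure_eqI)
      fix A assume A: "A \<in> sets \<nu>"
      have "emeasure \<nu> A = emeasure \<nu> (if m \<in> A then space \<nu> else {})"
        using AEm A by (intro emeasure_eq_AE) auto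
      also have "\<dots> = emeasure (return borel m) A"
        using A emeasure_space_1 by (auto simp del: emeasure_space_1 space_eq_univ)
      finally show "emeasure \<nu> A = emeasure (return borel m) A" .
    qed simp
    with \<nu>(3) show False by (auto simp: non_degenerate_def)
  qed
  have "(1 - t * m) * ((LINT x|\<nu>. x * b x) - m * integral\<^sup>L \<nu> b)
      = (LINT x|\<nu>. (1 - t * m) * (x * b x - m * b x))"
    by simp
  also have "\<dots> = (LINT x|\<nu>. (1 - s * m) * (x * a x - m * a x) + (t - s) * ((x - m)\<^sup>2 * a x * b x))"
  proof (rule integral_cong_AE)
    show "AE x in \<nu>. (1 - t * m) * (x * b x - m * b x) =
        (1 - s * m) * (x * a x - m * a x) + (t - s) * ((x - m)\<^sup>2 * a x * b x)"
      using pos'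
    proof eventually_elim
      case (elim x)
      have a1: "a x * (1 - s * x) = 1" and b1: "b x * (1 - t * x) = 1"
        using elim by (auto simp: a_def b_def)
      have "b x = b x * (a x * (1 - s * x))" and "a x = a x * (b x * (1 - t * x))"
        by (simp_all add: a1 b1)
      then show ?case by algebra
    qed
  qed measurable
  also have "\<dots> = (t - s) * (LINT x|\<nu>. (x - m)\<^sup>2 * a x * b x)"
    by (simp add: ms [symmetric])
  also have "\<dots> > 0" using nz \<open>s < t\<close> by simp
  finally have "(LINT x|\<nu>. x * b x) - m * integral\<^sup>L \<nu> b > 0"
    using tm by (simp add: zero_less_mult_iff)
  then have "m * integral\<^sup>L \<nu> b < cs_mean \<nu> t * integral\<^sup>L \<nu> b" by (simp add: mt)
  then show "cs_mean \<nu> s < cs_mean \<nu> t" using Mpos by (simp add: m_def)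
qed

end

theory Submission
  imports Defs "HOL-Complex_Analysis.Conformal_Mappings" "HOL-Real_Asymp.Real_Asymp"
begin

text \<open>
  With \<open>m = m(\<theta>)\<close> one has \<open>1 / M(\<theta>) = 1 - \<theta> m\<close> and \<open>\<theta> V(m) = (m - m0) (1 - \<theta> m)\<close>, hence
  \<open>V(m) + (m - m0) (m - x) = V(m) M(\<theta>) (1 - \<theta> x)\<close>, which is the formula for the density of
  \<open>P\<^sub>\<theta>\<close>. The mean extends holomorphically to a neighbourhood of \<open>0\<close> with derivative
  \<open>Var(\<nu>) > 0\<close> there; composing the second moment with its holomorphic inverse gives analyticity
  of \<open>V\<close>.

  Conversely, positivity of the denominator for one \<open>m > m0\<close> and one \<open>m < m0\<close> bounds the
  support of \<open>\<nu>\<close> on both sides. With \<open>\<theta>(m) = (m - m0) / (V(m) + m (m - m0))\<close> the density of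
  \<open>Q\<^sub>m\<close> is a multiple of \<open>1 / (1 - \<theta>(m) x)\<close>, so normalisation forces \<open>Q\<^sub>m = P\<^bsub>\<theta>(m)\<^esub>\<close>.
  Uniqueness: two transforms that agree near
  infinity agree on the upper half-plane by the identity theorem, and the Stieltjes inversion
  formula recovers the distribution function.
\<close>

section \<open>Integrals depending analytically on a parameter\<close>

text \<open>Expand \<open>1 / (1 - z * h x)\<close> as a geometric series and integrate term by
  term; since \<open>norm z * K < 1\<close>, the integrals of the norms are dominated by a
  convergent geometric series.\<close>

lemma (in finite_measure) geometric_kernel_sums:
  fixes f h :: "'a \<Rightarrow> complex"
  assumes [measurable]: "f \<in> borel_measurable M" "h \<in> borel_measurable M"
    and f: "AE x in M. norm (f x) \<le> C" and h: "AE x in M. norm (h x) \<le> K"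
    and K: "K \<ge> 0" "norm z * K < 1"
  shows "(\<lambda>n. (LINT x|M. f x * h x ^ n) * z ^ n) sums (LINT x|M. f x / (1 - z * h x))"
proof -
  define g where "g = (\<lambda>n x. f x * (z * h x) ^ n)"
  have [measurable]: "g n \<in> borel_measurable M" for n
    unfolding g_def by measurable
  have zh: "AE x in M. norm (z * h x) \<le> norm z * K"
    using h by eventually_elim (simp add: norm_mult mult_left_mono)
  \<comment> \<open>No sign is assumed for \<open>C\<close>, so its absolute value serves as the
    monotone factor.\<close>
  have bound: "AE x in M. norm (g n x) \<le> \<bar>C\<bar> * (norm z * K) ^ n" for n
    using f zh unfolding g_def norm_mult[of "f _"] norm_power
    by eventually_elim (intro mult_mono power_mono; auto)
  have int: "integrable M (g n)" for n
    by (rule integrable_const_bound[OF bound]) measurable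
  have geo: "summable (\<lambda>n. \<bar>C\<bar> * (norm z * K) ^ n * measure M (space M))"
    using K by (intro summable_mult summable_mult2 summable_geometric) auto
  have lt: "AE x in M. norm (z * h x) < 1"
    using zh K by auto
  have "(\<lambda>n. integral\<^sup>L M (g n)) sums (LINT x|M. (\<Sum>n. g n x))"
  proof (rule sums_integral[OF int])
    show "AE x in M. summable (\<lambda>n. norm (g n x))"
      using lt by eventually_elim (auto simp: g_def norm_mult norm_power intro!: summable_mult summable_geometric)
    show "summable (\<lambda>n. LINT x|M. norm (g n x))"
    proof (rule summable_comparison_test'[OF geo])
      fix n
      have "(LINT x|M. norm (g n x)) \<le> (LINT x|M. \<bar>C\<bar> * (norm z * K) ^ n)"
        using int bound by (intro integral_mono_AE) auto
      then show "norm (LINT x|M. norm (g n x)) \<le> \<bar>C\<bar> * (norm z * K) ^ n * measure M (space M)"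
        by (simp add: mult_ac)
    qed
  qed
  moreover have "(LINT x|M. (\<Sum>n. g n x)) = (LINT x|M. f x / (1 - z * h x))"
  proof (rule integral_cong_AE)
    show "AE x in M. (\<Sum>n. g n x) = f x / (1 - z * h x)"
      using lt
    proof eventually_elim
      case (elim x)
      then show ?case
        using sums_mult[OF geometric_sums, of "z * h x" "f x"] by (simp add: g_def sums_iff)
    qed
  qed measurable
  moreover have "integral\<^sup>L M (g n) = (LINT x|M. f x * h x ^ n) * z ^ n" for n
  proof -
    have "g n = (\<lambda>x. f x * h x ^ n * z ^ n)"
      by (simp add: g_def power_mult_distrib mult_ac)
    then show ?thesis by simp
  qed
  ultimately show ?thesis by simp
qed

text \<open>The integral is its own power series about \<open>0\<close>. It is applied with
  \<open>h x = x\<close> to moments and with \<open>h x = 1 / (x - w)\<close> to the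
  transform.\<close>

lemma (in finite_measure) geometric_kernel_holomorphic:
  fixes f h :: "'a \<Rightarrow> complex"
  assumes [measurable]: "f \<in> borel_measurable M" "h \<in> borel_measurable M"
    and f: "AE x in M. norm (f x) \<le> C" and h: "AE x in M. norm (h x) \<le> K"
    and K: "K > 0"
  shows "(\<lambda>z. LINT x|M. f x / (1 - z * h x)) holomorphic_on ball 0 (1 / K)"
proof (rule power_series_holomorphic)
  fix w :: complex assume "w \<in> ball 0 (1 / K)"
  then have "norm w * K < 1" using K by (simp add: field_simps)
  then show "(\<lambda>n. (LINT x|M. f x * h x ^ n) * (w - 0) ^ n) sums (LINT x|M. f x / (1 - w * h x))"
    using geometric_kernel_sums[OF assms(1,2) f h, of w] K by simp
qed

text \<open>At a real centre \<open>F\<close> has a complex Taylor series; because \<open>F\<close>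
  takes real values at real points of \<open>T\<close>, the real parts of its coefficients form a
  real power series for \<open>f\<close>.\<close>

lemma real_analytic_on_holomorphic:
  assumes F: "F holomorphic_on S" "open S"
    and f: "\<And>m. m \<in> T \<Longrightarrow> complex_of_real m \<in> S \<and> F (of_real m) = of_real (f m)" and "open T"
  shows "real_analytic_on f T"
  unfolding real_analytic_on_def
proof
  fix x assume x: "x \<in> T"
  obtain r1 where r1: "r1 > 0" "ball x r1 \<subseteq> T"
    using x \<open>open T\<close> openE by blast
  obtain r2 where r2: "r2 > 0" "ball (of_real x) r2 \<subseteq> S"
    using f[OF x] \<open>open S\<close> openE by blast
  define a where "a = (\<lambda>n. (deriv ^^ n) F (of_real x) / fact n)"
  have "(\<lambda>n. Re (a n) * (y - x) ^ n) sums f y" if "\<bar>y - x\<bar> < min r1 r2" for y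
  proof -
    have "y \<in> T" using that r1 by (auto simp: dist_real_def subset_eq)
    have "of_real y \<in> ball (complex_of_real x) r2"
      using that by (simp add: dist_real_def abs_minus_commute)
    moreover have "F holomorphic_on ball (of_real x) r2"
      using F(1) r2(2) holomorphic_on_subset by blast
    ultimately have "(\<lambda>n. a n * (of_real y - of_real x) ^ n) sums F (of_real y)"
      unfolding a_def by (intro holomorphic_power_series)
    from sums_Re[OF this] show ?thesis
      using f[OF \<open>y \<in> T\<close>] by (simp flip: of_real_diff of_real_power)
  qed
  then show "\<exists>a r. r > 0 \<and> (\<forall>y. \<bar>y - x\<bar> < r \<longrightarrow> (\<lambda>n. a n * (y - x) ^ n) sums f y)"
    using r1(1) r2(1) by (intro exI[of _ "\<lambda>n. Re (a n)"] exI[of _ "min r1 r2"]) auto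
qed

text \<open>A power series is continuous at its centre. This supplies the continuity of
  \<open>V\<close> at \<open>m0\<close> in the converse part.\<close>

lemma real_analytic_on_isCont:
  assumes "real_analytic_on f S" "x \<in> S"
  shows "isCont f x"
proof -
  obtain a r where r: "r > 0" and a: "\<And>y. \<bar>y - x\<bar> < r \<Longrightarrow> (\<lambda>n. a n * (y - x) ^ n) sums f y"
    using assms unfolding real_analytic_on_def by blast
  define p where "p = (\<lambda>h. \<Sum>n. a n * h ^ n)"
  \<comment> \<open>Convergence at a single nonzero point suffices for continuity at
    \<open>0\<close>.\<close>
  have "summable (\<lambda>n. a n * (r / 2) ^ n)"
    using a[of "x + r / 2"] r by (simp add: sums_iff)
  then have "isCont p 0"
    unfolding p_def by (rule isCont_powser) (use r in simp)
  then have "isCont (\<lambda>y. p (y - x)) x"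
    using isCont_o2[of x "\<lambda>y. y - x" p] by simp
  moreover have "\<forall>\<^sub>F y in nhds x. f y = p (y - x)"
    using eventually_nhds_ball[OF r, of x]
  proof eventually_elim
    case (elim y)
    then show ?case
      using a[of y] by (simp add: p_def sums_iff dist_real_def abs_minus_commute)
  qed
  ultimately show ?thesis
    using isCont_cong by metis
qed

section \<open>The Cauchy-Stieltjes transform determines the measure\<close>

text \<open>Near \<open>w\<close> the kernel \<open>1 / (u - x)\<close> equals
  \<open>- h x / (1 - (u - w) * h x)\<close> with \<open>h x = 1 / (x - w)\<close>, and
  \<open>h\<close> is bounded by \<open>1 / Im w\<close> for real \<open>x\<close>.\<close>

lemma cauchy_stieltjes_holomorphic:
  assumes "real_distribution \<nu>"
  shows "cauchy_stieltjes \<nu> holomorphic_on {z. Im z > 0}"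
proof -
  interpret real_distribution \<nu> by fact
  have "\<exists>r>0. cauchy_stieltjes \<nu> holomorphic_on ball w r" if w: "Im w > 0" for w
  proof -
    define h where "h = (\<lambda>x. 1 / (complex_of_real x - w))"
    have h_bound: "norm (h x) \<le> 1 / Im w" for x
    proof -
      have "Im w \<le> norm (complex_of_real x - w)"
        using abs_Im_le_cmod[of "complex_of_real x - w"] w by simp
      then show ?thesis using w by (simp add: h_def norm_divide frac_le)
    qed
    have [measurable]: "h \<in> borel_measurable \<nu>"
      unfolding h_def by measurable
    have hol: "(\<lambda>z. LINT x|\<nu>. - h x / (1 - z * h x)) holomorphic_on ball 0 (Im w)"
      using geometric_kernel_holomorphic[of "\<lambda>x. - h x" h "1 / Im w" "1 / Im w"] h_bound w by simp
    have "(\<lambda>u. LINT x|\<nu>. - h x / (1 - (u - w) * h x)) holomorphic_on ball w (Im w)"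
      by (rule holomorphic_on_compose_gen[of "\<lambda>u. u - w", OF _ hol, unfolded o_def])
        (auto simp: dist_norm norm_minus_commute intro!: holomorphic_intros)
    moreover have "(LINT x|\<nu>. - h x / (1 - (u - w) * h x)) = cauchy_stieltjes \<nu> u" for u
      unfolding cauchy_stieltjes_def
    proof (rule Bochner_Integration.integral_cong)
      fix x
      have "complex_of_real x - w \<noteq> 0" using w by (auto simp: complex_eq_iff)
      then have "1 - (u - w) * h x = (u - of_real x) * - h x"
        by (simp add: h_def field_simps)
      moreover have "h x \<noteq> 0" using \<open>complex_of_real x - w \<noteq> 0\<close> by (simp add: h_def)
      ultimately show "- h x / (1 - (u - w) * h x) = 1 / (u - of_real x)"
        by simp
    qed simp
    ultimately show ?thesis using w by auto
  qed
  then show ?thesis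
    by (force simp: holomorphic_on_open open_halfspace_Im_gt)
qed

section \<open>Stieltjes inversion\<close>

text \<open>The imaginary part turns the transform into a Poisson integral; after Fubini the inner
  integral over \<open>x\<close> has an \<open>arctan\<close> primitive.\<close>

lemma (in real_distribution) integral_poisson_kernel:
  assumes "y > 0" "a \<le> b"
  shows "(LBINT x. - Im (cauchy_stieltjes M (Complex x y)) * indicator {a..b} x) =
    (LINT t|M. arctan ((b - t) / y) - arctan ((a - t) / y))"
proof -
  interpret pair_sigma_finite M lborel ..
  \<comment> \<open>This is \<open>pi\<close> times the Poisson kernel of the upper
    half-plane.\<close>
  define k where "k = (\<lambda>t x. y / ((x - t)\<^sup>2 + y\<^sup>2))"
  have k_bound: "0 \<le> k t x" "k t x \<le> 1 / y" for t x
  proof -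
    have "y\<^sup>2 \<le> (x - t)\<^sup>2 + y\<^sup>2" by simp
    moreover have "y\<^sup>2 > 0" using \<open>y > 0\<close> by simp
    ultimately have "k t x \<le> y / y\<^sup>2"
      unfolding k_def using \<open>y > 0\<close> by (intro divide_left_mono mult_pos_pos) linarith+
    then show "k t x \<le> 1 / y" using \<open>y > 0\<close> by (simp add: power2_eq_square)
    show "0 \<le> k t x" using \<open>y > 0\<close> by (simp add: k_def)
  qed
  have [measurable]: "(\<lambda>p. k (fst p) (snd p)) \<in> borel_measurable (M \<Otimes>\<^sub>M lborel)"
    unfolding k_def by measurable
  have int: "integrable (M \<Otimes>\<^sub>M lborel) (\<lambda>(t, x). k t x * indicator {a..b} x)"
  proof (rule integrableI_bounded_set[where A = "space M \<times> {a..b}" and B = "1 / y"])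
    show "emeasure (M \<Otimes>\<^sub>M lborel) (space M \<times> {a..b}) < \<infinity>"
      by (subst lborel.emeasure_pair_measure_Times) (use assms in \<open>auto simp: emeasure_eq_measure ennreal_mult_less_top\<close>)
    show "AE p in M \<Otimes>\<^sub>M lborel. p \<in> space M \<times> {a..b} \<longrightarrow>
        norm (case p of (t, x) \<Rightarrow> k t x * indicator {a..b} x) \<le> 1 / y"
      using k_bound by (intro AE_I2) (auto simp: indicator_def)
  qed (auto simp: case_prod_beta indicator_def intro!: AE_I2)
  have "- Im (cauchy_stieltjes M (Complex x y)) = (LINT t|M. k t x)" for x
  proof -
    have "norm (1 / (Complex x y - of_real t)) \<le> 1 / y" for t
    proof -
      have "y \<le> norm (Complex x y - of_real t)"
        using abs_Im_le_cmod[of "Complex x y - of_real t"] \<open>y > 0\<close> by simp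
      then show ?thesis using \<open>y > 0\<close> by (simp add: norm_divide frac_le)
    qed
    then have "integrable M (\<lambda>t. 1 / (Complex x y - of_real t))"
      by (intro integrable_const_bound[of _ "1 / y"]) auto
    then have "Im (cauchy_stieltjes M (Complex x y)) = (LINT t|M. Im (1 / (Complex x y - of_real t)))"
      unfolding cauchy_stieltjes_def by simp
    also have "\<dots> = (LINT t|M. - k t x)"
      by (intro Bochner_Integration.integral_cong) (auto simp: k_def Im_divide)
    finally show ?thesis by simp
  qed
  then have "(LBINT x. - Im (cauchy_stieltjes M (Complex x y)) * indicator {a..b} x) =
      (LBINT x. (LINT t|M. k t x * indicator {a..b} x))"
    by simp
  also have "\<dots> = (LINT t|M. (LBINT x. k t x * indicator {a..b} x))"
    by (rule Fubini_integral[OF int])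
  also have "\<dots> = (LINT t|M. arctan ((b - t) / y) - arctan ((a - t) / y))"
  proof (rule Bochner_Integration.integral_cong)
    fix t
    show "(LBINT x. k t x * indicator {a..b} x) = arctan ((b - t) / y) - arctan ((a - t) / y)"
    proof (rule integral_FTC_Icc_nonneg)
      show "((\<lambda>x. arctan ((x - t) / y)) has_real_derivative k t x) (at x)" for x
      proof -
        have "inverse (1 + ((x - t) / y)\<^sup>2) * (1 / y) = k t x"
          using \<open>y > 0\<close> by (simp add: k_def field_simps power2_eq_square add_pos_nonneg)
        moreover have "((\<lambda>x. arctan ((x - t) / y)) has_real_derivative
            inverse (1 + ((x - t) / y)\<^sup>2) * (1 / y)) (at x)"
          using \<open>y > 0\<close> by (auto intro!: derivative_eq_intros)
        ultimately show ?thesis by simp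
      qed
    qed (use k_bound assms in \<open>auto simp: k_def\<close>)
  qed simp
  finally show ?thesis .
qed

text \<open>At height \<open>1 / Suc n\<close> the \<open>arctan\<close> terms tend to
  \<open>pi / 2\<close> times signs, dominated by \<open>pi\<close>. For \<open>a < b\<close> the
  limit is \<open>pi\<close> times the mass of the interval, with atoms at the endpoints counted by
  half.\<close>

lemma (in real_distribution) stieltjes_inversion_limit:
  assumes "a \<le> b"
  shows "(\<lambda>n. LBINT x. - Im (cauchy_stieltjes M (Complex x (1 / Suc n))) * indicator {a..b} x)
    \<longlonglongrightarrow> pi / 2 * (LINT t|M. sgn (b - t) - sgn (a - t))"
proof -
  have lim: "(\<lambda>n. arctan (c * real (Suc n))) \<longlonglongrightarrow> pi / 2 * sgn c" for c :: real
  proof -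
    consider "c > 0" | "c = 0" | "c < 0" by linarith
    then show ?thesis
    proof cases
      case 1
      then have "filterlim (\<lambda>n. c * real (Suc n)) at_top sequentially" by real_asymp
      then show ?thesis using filterlim_compose[OF tendsto_arctan_at_top] 1 by simp
    next
      case 3
      then have "filterlim (\<lambda>n. c * real (Suc n)) at_bot sequentially" by real_asymp
      then show ?thesis using filterlim_compose[OF tendsto_arctan_at_bot] 3 by simp
    qed simp
  qed
  have "(\<lambda>n. LINT t|M. arctan ((b - t) * Suc n) - arctan ((a - t) * Suc n))
      \<longlonglongrightarrow> (LINT t|M. pi / 2 * (sgn (b - t) - sgn (a - t)))"
  proof (rule integral_dominated_convergence[where w = "\<lambda>_. pi"])
    show "AE t in M. (\<lambda>n. arctan ((b - t) * Suc n) - arctan ((a - t) * Suc n))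
        \<longlonglongrightarrow> pi / 2 * (sgn (b - t) - sgn (a - t))"
      unfolding right_diff_distrib by (intro AE_I2 tendsto_diff lim)
    show "AE t in M. norm (arctan ((b - t) * Suc n) - arctan ((a - t) * Suc n)) \<le> pi" for n
    proof (rule AE_I2)
      fix t
      show "norm (arctan ((b - t) * Suc n) - arctan ((a - t) * Suc n)) \<le> pi"
        using arctan_bounded[of "(b - t) * Suc n"] arctan_bounded[of "(a - t) * Suc n"]
        unfolding real_norm_def by linarith
    qed
  qed auto
  then show ?thesis
    using integral_poisson_kernel[OF _ assms] by simp
qed

text \<open>Approaching \<open>b\<close> from the right counts an atom at \<open>b\<close> in full
  instead of by half, and the left endpoint escapes to minus infinity.\<close>

lemma (in real_distribution) sgn_integral_tendsto_cdf:
  "(\<lambda>n. LINT t|M. sgn (b + 1 / Suc n - t) - sgn (b - real n - t)) \<longlonglongrightarrow> 2 * cdf M b"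
proof -
  have "(\<lambda>n. LINT t|M. sgn (b + 1 / Suc n - t) - sgn (b - real n - t))
      \<longlonglongrightarrow> (LINT t|M. 2 * indicator {..b} t)"
  proof (rule integral_dominated_convergence[where w = "\<lambda>_. 2"])
    show "AE t in M. (\<lambda>n. sgn (b + 1 / Suc n - t) - sgn (b - real n - t))
        \<longlonglongrightarrow> 2 * indicator {..b} t"
    proof (rule AE_I2)
      fix t
      have "\<forall>\<^sub>F n in sequentially. b - real n - t < 0"
        by real_asymp
      then have "\<forall>\<^sub>F n in sequentially.
          2 * indicator {..b} t = sgn (b + 1 / Suc n - t) - sgn (b - real n - t)"
      proof (cases "t \<le> b")
        case True
        then have "b + 1 / Suc n - t > 0" for n
          by (smt (verit) divide_pos_pos of_nat_0_less_iff zero_less_Suc)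
        with \<open>eventually _ _\<close> True show ?thesis
          by (auto elim!: eventually_mono)
      next
        case False
        then have "\<forall>\<^sub>F n in sequentially. b + 1 / Suc n - t < 0"
          by real_asymp
        with \<open>\<forall>\<^sub>F n in sequentially. b - real n - t < 0\<close> show ?thesis
          by eventually_elim (use False in auto)
      qed
      then show "(\<lambda>n. sgn (b + 1 / Suc n - t) - sgn (b - real n - t)) \<longlonglongrightarrow> 2 * indicator {..b} t"
        by (rule tendsto_eventually[OF eventually_mono]) simp
    qed
    show "AE t in M. norm (sgn (b + 1 / Suc n - t) - sgn (b - real n - t)) \<le> 2" for n
      by (intro AE_I2) (auto simp: sgn_real_def)
  qed auto
  then show ?thesis
    by (simp add: cdf_def)
qed

text \<open>Equality is asked only off the real axis, where \<open>1 / (z - x)\<close> is bounded in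
  \<open>x\<close>, so that the transform makes sense even for measures of unbounded
  support.\<close>

theorem cauchy_stieltjes_unique:
  assumes \<mu>: "real_distribution \<mu>" and \<nu>: "real_distribution \<nu>"
    and eq: "\<forall>\<^sub>F z in at_infinity. Im z \<noteq> 0 \<longrightarrow> cauchy_stieltjes \<mu> z = cauchy_stieltjes \<nu> z"
  shows "\<mu> = \<nu>"
proof (rule cdf_unique[OF \<mu> \<nu>], rule ext)
  interpret \<mu>: real_distribution \<mu> by fact
  interpret \<nu>: real_distribution \<nu> by fact
  obtain R where R: "\<And>z. norm z \<ge> R \<Longrightarrow> Im z \<noteq> 0 \<Longrightarrow> cauchy_stieltjes \<mu> z = cauchy_stieltjes \<nu> z"
    using eq unfolding eventually_at_infinity by blast
  have upper: "cauchy_stieltjes \<mu> z = cauchy_stieltjes \<nu> z" if "Im z > 0" for z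
  \<comment> \<open>Points with \<open>Im z > max R 0\<close> have norm above \<open>R\<close>, so
    the transforms agree on that half-plane; the identity theorem extends this to all of
    \<open>Im z > 0\<close>.\<close>
  proof (rule analytic_continuation_open[where f = "cauchy_stieltjes \<mu>" and g = "cauchy_stieltjes \<nu>"])
    show "open {z. Im z > max R 0}" "open {z. Im z > 0}"
      by (rule open_halfspace_Im_gt)+
    show "connected {z. Im z > 0}"
      by (intro convex_connected convex_halfspace_Im_gt)
    have "Complex 0 (max R 0 + 1) \<in> {z. Im z > max R 0}" by (simp add: max_def)
    then show "{z. Im z > max R 0} \<noteq> {}" by blast
    show "cauchy_stieltjes \<mu> z = cauchy_stieltjes \<nu> z" if "z \<in> {z. Im z > max R 0}" for z
      using that abs_Im_le_cmod[of z] by (intro R) auto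
  qed (use that \<mu> \<nu> in \<open>auto intro: cauchy_stieltjes_holomorphic\<close>)
  \<comment> \<open>The inversion formula samples the transforms only at heights
    \<open>1 / Suc n > 0\<close>, where they coincide.\<close>
  have sgn_eq: "(LINT t|\<mu>. sgn (b - t) - sgn (a - t)) = (LINT t|\<nu>. sgn (b - t) - sgn (a - t))"
    if "a \<le> b" for a b
  proof -
    have "(\<lambda>n. LBINT x. - Im (cauchy_stieltjes \<mu> (Complex x (1 / Suc n))) * indicator {a..b} x)
        \<longlonglongrightarrow> pi / 2 * (LINT t|\<nu>. sgn (b - t) - sgn (a - t))"
      using \<nu>.stieltjes_inversion_limit[OF that] by (simp add: upper)
    from LIMSEQ_unique[OF \<mu>.stieltjes_inversion_limit[OF that] this] show ?thesis by simp
  qed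
  fix b
  have "(LINT t|\<mu>. sgn (b + 1 / Suc n - t) - sgn (b - real n - t)) =
      (LINT t|\<nu>. sgn (b + 1 / Suc n - t) - sgn (b - real n - t))" for n
    by (rule sgn_eq) (smt (verit) divide_nonneg_nonneg of_nat_0_le_iff)
  then have "(\<lambda>n. LINT t|\<mu>. sgn (b + 1 / Suc n - t) - sgn (b - real n - t)) \<longlonglongrightarrow> 2 * cdf \<nu> b"
    using \<nu>.sgn_integral_tendsto_cdf[of b] by simp
  from LIMSEQ_unique[OF \<mu>.sgn_integral_tendsto_cdf this] show "cdf \<mu> b = cdf \<nu> b" by simp
qed

section \<open>The variance function\<close>

lemma (in real_distribution) eq_return_if_AE_eq:
  assumes "AE x in M. x = c"
  shows "M = return borel c"
proof (rule measure_eqI)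
  fix A assume A: "A \<in> sets M"
  have "emeasure M A = emeasure M (if c \<in> A then space M else {})"
    using assms A by (intro emeasure_eq_AE) auto
  also have "\<dots> = emeasure (return borel c) A"
    using A emeasure_space_1 by (auto simp del: emeasure_space_1 space_eq_univ)
  finally show "emeasure M A = emeasure (return borel c) A" .
qed simp

text \<open>A vanishing integral of a nonnegative function would force \<open>x = c\<close> almost
  everywhere, that is, a point mass at \<open>c\<close>.\<close>

lemma (in real_distribution) weighted_second_moment_pos:
  assumes "non_degenerate M" "integrable M (\<lambda>x. (x - c)\<^sup>2 * w x)" "AE x in M. w x > 0"
  shows "(LINT x|M. (x - c)\<^sup>2 * w x) > 0"
proof -
  have nn: "AE x in M. 0 \<le> (x - c)\<^sup>2 * w x"
    using assms(3) by eventually_elim simp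
  have "(LINT x|M. (x - c)\<^sup>2 * w x) \<noteq> 0"
  proof
    assume "(LINT x|M. (x - c)\<^sup>2 * w x) = 0"
    then have "AE x in M. (x - c)\<^sup>2 * w x = 0"
      using integral_nonneg_eq_0_iff_AE[OF assms(2) nn] by simp
    with assms(3) have "AE x in M. x = c" by eventually_elim auto
    then show False
      using assms(1) eq_return_if_AE_eq by (auto simp: non_degenerate_def)
  qed
  then show ?thesis using integral_nonneg_AE[OF nn] by linarith
qed

lemma AE_cs_radius:
  assumes "real_distribution \<nu>" "cs_radius \<nu> \<epsilon>" "\<theta> \<in> {-\<epsilon><..<\<epsilon>}"
  shows "AE x in \<nu>. 1 - \<theta> * x > 0"
  using AE_in_msupport[OF assms(1)] assms(2,3) by (auto simp: cs_radius_def)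

section \<open>Moment identities of a Cauchy-Stieltjes family\<close>

locale cs_family = real_distribution \<nu> for \<nu> +
  fixes \<epsilon> m0 :: real
  assumes compact_supp: "compactly_supported \<nu>" and nondeg: "non_degenerate \<nu>"
    and mean: "(LINT x|\<nu>. x) = m0" and radius: "cs_radius \<nu> \<epsilon>"
begin

lemma real_distribution_\<nu>: "real_distribution \<nu>" ..

text \<open>This is the second moment of \<open>cs_P \<nu> \<theta>\<close> before division by
  \<open>cs_M \<nu> \<theta>\<close>.\<close>

definition cs_second :: "real \<Rightarrow> real" where
  "cs_second \<theta> = (LINT x|\<nu>. x\<^sup>2 / (1 - \<theta> * x))"

lemma integrable_kernel:
  assumes "\<theta> \<in> {-\<epsilon><..<\<epsilon>}" "continuous_on UNIV f"
  shows "integrable \<nu> (\<lambda>x. f x / (1 - \<theta> * x))"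
proof (rule integrable_continuous_on_msupport[OF real_distribution_\<nu> compact_supp])
  have "1 - \<theta> * x \<noteq> 0" if "x \<in> msupport \<nu>" for x
    using that assms(1) radius by (force simp: cs_radius_def)
  then show "continuous_on (msupport \<nu>) (\<lambda>x. f x / (1 - \<theta> * x))"
    using assms(2) by (auto intro!: continuous_intros elim: continuous_on_subset)
  have [measurable]: "f \<in> borel_measurable borel"
    using assms(2) by (rule borel_measurable_continuous_onI)
  show "(\<lambda>x. f x / (1 - \<theta> * x)) \<in> borel_measurable borel" by measurable
qed

lemma integrable_id: "integrable \<nu> (\<lambda>x. x)"
  by (rule integrable_continuous_on_msupport[OF real_distribution_\<nu> compact_supp]) auto

lemma M_pos: "\<theta> \<in> {-\<epsilon><..<\<epsilon>} \<Longrightarrow> cs_M \<nu> \<theta> > 0"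
  using radius by (simp add: cs_radius_def)

lemma zero_in_range: "0 \<in> {-\<epsilon><..<\<epsilon>}"
  using radius by (simp add: cs_radius_def)

lemma mean_zero: "cs_mean \<nu> 0 = m0"
  using cs_mean_eq[OF real_distribution_\<nu> radius zero_in_range] mean prob_space by (simp add: cs_M_def)

lemma psi_mean: "\<theta> \<in> {-\<epsilon><..<\<epsilon>} \<Longrightarrow> cs_psi \<nu> \<epsilon> (cs_mean \<nu> \<theta>) = \<theta>"
  unfolding cs_psi_def
  by (intro the_inv_into_f_f strict_mono_on_imp_inj_on
      strict_mono_on_cs_mean[OF real_distribution_\<nu> compact_supp nondeg radius])

lemma first_moment:
  assumes "\<theta> \<in> {-\<epsilon><..<\<epsilon>}"
  shows "(LINT x|\<nu>. x / (1 - \<theta> * x)) = cs_mean \<nu> \<theta> * cs_M \<nu> \<theta>"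
  using cs_mean_eq[OF real_distribution_\<nu> radius assms] M_pos[OF assms] by simp

text \<open>Integrate \<open>1 / (1 - \<theta> * x) = 1 + \<theta> * (x / (1 - \<theta> *
  x))\<close>.\<close>

lemma M_eq:
  assumes "\<theta> \<in> {-\<epsilon><..<\<epsilon>}"
  shows "cs_M \<nu> \<theta> = 1 + \<theta> * (cs_mean \<nu> \<theta> * cs_M \<nu> \<theta>)"
proof -
  have "cs_M \<nu> \<theta> = (LINT x|\<nu>. 1 + \<theta> * (x / (1 - \<theta> * x)))"
    unfolding cs_M_def
    by (rule integral_cong_AE) (use AE_cs_radius[OF real_distribution_\<nu> radius assms] in
      \<open>auto simp: field_simps elim!: eventually_mono\<close>)
  also have "\<dots> = 1 + \<theta> * (LINT x|\<nu>. x / (1 - \<theta> * x))"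
    using integrable_kernel[OF assms, of "\<lambda>x. x"] prob_space
    by (simp del: times_divide_eq_right)
  finally show ?thesis unfolding first_moment[OF assms] .
qed

text \<open>The same expansion one degree higher: \<open>x / (1 - \<theta> * x)\<close> is
  \<open>x\<close> plus \<open>\<theta>\<close> times the second-moment kernel.\<close>

lemma mean_M_eq:
  assumes "\<theta> \<in> {-\<epsilon><..<\<epsilon>}"
  shows "cs_mean \<nu> \<theta> * cs_M \<nu> \<theta> = m0 + \<theta> * cs_second \<theta>"
proof -
  have "(LINT x|\<nu>. x / (1 - \<theta> * x)) = (LINT x|\<nu>. x + \<theta> * (x\<^sup>2 / (1 - \<theta> * x)))"
    by (rule integral_cong_AE) (use AE_cs_radius[OF real_distribution_\<nu> radius assms] in
      \<open>auto simp: field_simps power2_eq_square elim!: eventually_mono\<close>)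
  also have "\<dots> = m0 + \<theta> * cs_second \<theta>"
    using integrable_kernel[OF assms, of "\<lambda>x. x\<^sup>2"] integrable_id mean
    by (simp add: cs_second_def continuous_intros del: times_divide_eq_right)
  finally show ?thesis unfolding first_moment[OF assms] .
qed

text \<open>Expanding \<open>(x - m)\<^sup>2\<close> reduces the variance to the three kernel
  integrals of degree 0, 1 and 2; positivity comes from non-degeneracy, with the density of
  \<open>cs_P\<close> as weight.\<close>

lemma
  assumes \<theta>: "\<theta> \<in> {-\<epsilon><..<\<epsilon>}" and m: "m = cs_mean \<nu> \<theta>"
  shows variance_eq: "cs_variance \<nu> \<epsilon> m = cs_second \<theta> / cs_M \<nu> \<theta> - m\<^sup>2"
    and variance_pos: "cs_variance \<nu> \<epsilon> m > 0"
proof -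
  note AE = AE_cs_radius[OF real_distribution_\<nu> radius \<theta>]
  have pos: "AE x in \<nu>. 1 / (cs_M \<nu> \<theta> * (1 - \<theta> * x)) > 0"
    using AE by eventually_elim (use M_pos[OF \<theta>] in simp)
  have "cs_variance \<nu> \<epsilon> m = (LINT x|cs_P \<nu> \<theta>. (x - m)\<^sup>2)"
    by (simp add: cs_variance_def m psi_mean[OF \<theta>])
  also have "\<dots> = (LINT x|\<nu>. (1 / (cs_M \<nu> \<theta> * (1 - \<theta> * x))) *\<^sub>R (x - m)\<^sup>2)"
    unfolding cs_P_def using pos by (intro integral_density) (auto elim!: eventually_mono)
  also have "\<dots> = (LINT x|\<nu>. (x - m)\<^sup>2 * (1 / (cs_M \<nu> \<theta> * (1 - \<theta> * x))))"
    by (simp add: mult.commute)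
  finally have 1: "cs_variance \<nu> \<epsilon> m = (LINT x|\<nu>. (x - m)\<^sup>2 * (1 / (cs_M \<nu> \<theta> * (1 - \<theta> * x))))" .
  have eq: "(\<lambda>x. (x - m)\<^sup>2 * (1 / (cs_M \<nu> \<theta> * (1 - \<theta> * x)))) =
      (\<lambda>x. (1 / cs_M \<nu> \<theta>) * (x\<^sup>2 / (1 - \<theta> * x) - 2 * m * (x / (1 - \<theta> * x)) + m\<^sup>2 * (1 / (1 - \<theta> * x))))"
    by (rule ext) (simp add: power2_diff add_divide_distrib diff_divide_distrib algebra_simps)
  have int: "integrable \<nu> (\<lambda>x. x\<^sup>2 / (1 - \<theta> * x))" "integrable \<nu> (\<lambda>x. x / (1 - \<theta> * x))"
      "integrable \<nu> (\<lambda>x. 1 / (1 - \<theta> * x))"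
    by (auto intro!: integrable_kernel[OF \<theta>] continuous_intros)
  have "(LINT x|\<nu>. x\<^sup>2 / (1 - \<theta> * x) - 2 * m * (x / (1 - \<theta> * x)) + m\<^sup>2 * (1 / (1 - \<theta> * x))) =
      cs_second \<theta> - 2 * m * (m * cs_M \<nu> \<theta>) + m\<^sup>2 * cs_M \<nu> \<theta>"
    using int by (simp add: cs_second_def first_moment[OF \<theta>] m cs_M_def del: times_divide_eq_right)
  then have "(LINT x|\<nu>. (x - m)\<^sup>2 * (1 / (cs_M \<nu> \<theta> * (1 - \<theta> * x)))) =
      (1 / cs_M \<nu> \<theta>) * (cs_second \<theta> - 2 * m * (m * cs_M \<nu> \<theta>) + m\<^sup>2 * cs_M \<nu> \<theta>)"
    unfolding eq integral_mult_right_zero by (rule arg_cong)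
  then show "cs_variance \<nu> \<epsilon> m = cs_second \<theta> / cs_M \<nu> \<theta> - m\<^sup>2"
    using M_pos[OF \<theta>] unfolding 1 by (simp add: field_simps power2_eq_square)
  show "cs_variance \<nu> \<epsilon> m > 0"
    unfolding 1
  proof (rule weighted_second_moment_pos[OF nondeg _ pos])
    show "integrable \<nu> (\<lambda>x. (x - m)\<^sup>2 * (1 / (cs_M \<nu> \<theta> * (1 - \<theta> * x))))"
      unfolding eq by (intro integrable_mult_right Bochner_Integration.integrable_diff
          Bochner_Integration.integrable_add int)
  qed
qed

text \<open>Eliminate \<open>cs_second\<close> through \<open>mean_M_eq\<close> and
  \<open>1 / cs_M\<close> through \<open>M_eq\<close>. Solved for \<open>\<theta>\<close> when
  \<open>m \<noteq> m0\<close>, this reads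
  \<open>1 / \<theta> = m + V(m) / (m - m0)\<close>.\<close>

lemma theta_variance:
  assumes \<theta>: "\<theta> \<in> {-\<epsilon><..<\<epsilon>}" and m: "m = cs_mean \<nu> \<theta>"
  shows "\<theta> * cs_variance \<nu> \<epsilon> m = (m - m0) * (1 - \<theta> * m)"
proof -
  let ?M = "cs_M \<nu> \<theta>"
  have "?M * (1 - \<theta> * m) = 1"
    using M_eq[OF \<theta>] by (simp add: m algebra_simps)
  then have inv: "1 / ?M = 1 - \<theta> * m"
    using M_pos[OF \<theta>] by (simp add: field_simps)
  have "\<theta> * cs_variance \<nu> \<epsilon> m = (\<theta> * cs_second \<theta>) * (1 / ?M) - \<theta> * m\<^sup>2"
    by (simp add: variance_eq[OF \<theta> m] algebra_simps)
  also have "\<theta> * cs_second \<theta> = m * ?M - m0"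
    using mean_M_eq[OF \<theta>] by (simp add: m)
  also have "(m * ?M - m0) * (1 / ?M) = m - m0 * (1 - \<theta> * m)"
    unfolding inv [symmetric] using M_pos[OF \<theta>] by (simp add: field_simps)
  finally show ?thesis by (simp add: algebra_simps power2_eq_square)
qed

lemma cs_P_eq_cs_Q:
  assumes \<theta>: "\<theta> \<in> {-\<epsilon><..<\<epsilon>}" and m: "m = cs_mean \<nu> \<theta>"
  shows "cs_P \<nu> \<theta> = cs_Q \<nu> m0 (cs_variance \<nu> \<epsilon>) m"
proof -
  let ?v = "cs_variance \<nu> \<epsilon> m" and ?M = "cs_M \<nu> \<theta>"
  have M1: "?M * (1 - \<theta> * m) = 1"
    using M_eq[OF \<theta>] by (simp add: m algebra_simps)
  have denom: "?v + (m - m0) * (m - x) = ?v * (?M * (1 - \<theta> * x))" for x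
  \<comment> \<open>The identity is obtained after multiplication by \<open>\<theta>\<close>, so
    \<open>\<theta> = 0\<close> is separate: there \<open>m = m0\<close> and the normalising
    constant is 1.\<close>
  proof (cases "\<theta> = 0")
    case True
    then show ?thesis using mean_zero m M1 by simp
  next
    case False
    have "\<theta> * (?v + (m - m0) * (m - x)) = (m - m0) * (1 - \<theta> * x)"
      using theta_variance[OF \<theta> m] by (simp add: algebra_simps)
    also have "\<dots> = (m - m0) * (1 - \<theta> * x) * (?M * (1 - \<theta> * m))"
      by (simp add: M1)
    also have "\<dots> = ((m - m0) * (1 - \<theta> * m)) * (?M * (1 - \<theta> * x))"
      by (simp only: mult_ac)
    also have "\<dots> = \<theta> * (?v * (?M * (1 - \<theta> * x)))"
      by (simp add: theta_variance[OF \<theta> m, symmetric])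
    finally show ?thesis using False by simp
  qed
  show ?thesis
    unfolding cs_P_def cs_Q_def denom using variance_pos[OF \<theta> m] by simp
qed

lemma support_bound: obtains K where "K > 0" "AE x in \<nu>. \<bar>x\<bar> \<le> K"
proof -
  obtain K where "K > 0" "\<forall>x\<in>msupport \<nu>. \<bar>x\<bar> \<le> K"
    using compact_supp unfolding compactly_supported_def
    by (metis bounded_pos compact_imp_bounded real_norm_def)
  then show ?thesis using AE_in_msupport[OF real_distribution_\<nu>]
    by (intro that[of K]) (auto elim: eventually_mono)
qed

section \<open>Analyticity of the variance function\<close>

text \<open>The variance is \<open>N 2 (g w) / N 0 (g w) - w\<^sup>2\<close> on real
  \<open>w\<close>, where \<open>N k\<close> is the complexified kernel integral of degree
  \<open>k\<close> and \<open>g\<close> inverts the complexified mean. The endpoints are means at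
  \<open>-s\<close> and \<open>s\<close>, so the intermediate value theorem makes every point
  between them a mean.\<close>

lemma variance_analytic_near_mean:
  obtains A B where "A < m0" "m0 < B" "{A<..<B} \<subseteq> cs_mean \<nu> ` {-\<epsilon><..<\<epsilon>}"
    "real_analytic_on (cs_variance \<nu> \<epsilon>) {A<..<B}"
proof -
  obtain K where K: "K > 0" "AE x in \<nu>. \<bar>x\<bar> \<le> K" by (rule support_bound)
  define N where "N = (\<lambda>k z. LINT x|\<nu>. complex_of_real x ^ k / (1 - z * of_real x))"
  have hol: "N k holomorphic_on ball 0 (1 / K)" for k
    unfolding N_def
  proof (rule geometric_kernel_holomorphic)
    show "AE x in \<nu>. norm (complex_of_real x ^ k) \<le> K ^ k"
      using K(2) by eventually_elim (simp add: norm_power power_mono)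
  qed (use K in auto)
  have N_real: "N k (of_real \<theta>) = of_real (LINT x|\<nu>. x ^ k / (1 - \<theta> * x))" for k \<theta>
    unfolding N_def by (simp flip: integral_complex_of_real)
  have N0: "N k 0 = of_real (LINT x|\<nu>. x ^ k)" for k
    using N_real[of k 0] by simp
  have N_0: "N 0 0 = 1" using N0[of 0] prob_space by simp
  have "continuous_on (ball 0 (1 / K)) (N 0)"
    using hol by (rule holomorphic_on_imp_continuous_on)
  then have "isCont (N 0) 0"
    using K(1) by (auto simp: continuous_on_eq_continuous_at dest: bspec[of _ _ 0])
  then have "\<forall>\<^sub>F z in nhds 0. N 0 z \<noteq> 0"
    using K(1) N_0 by (intro tendsto_imp_eventually_ne[where c = "N 0 0"])
      (auto simp: isCont_def tendsto_nhds_iff)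
  then obtain \<delta> where \<delta>: "\<delta> > 0" "\<And>z. z \<in> ball 0 \<delta> \<Longrightarrow> N 0 z \<noteq> 0"
    unfolding eventually_nhds_metric by (auto simp: dist_commute)
  \<comment> \<open>The three radii ensure, in order, that \<open>N 0\<close> has no zero, that the
    series converge, and that real points lie in the parameter interval.\<close>
  define D where "D = ball (0 :: complex) (min \<delta> (min (1 / K) \<epsilon>))"
  have "\<epsilon> > 0" using radius by (simp add: cs_radius_def)
  have D: "open D" "0 \<in> D" "\<And>z. z \<in> D \<Longrightarrow> N 0 z \<noteq> 0"
    using \<delta> K(1) \<open>\<epsilon> > 0\<close> by (auto simp: D_def)
  have holD: "N k holomorphic_on D" for k
    using hol[of k] by (rule holomorphic_on_subset) (auto simp: D_def)
  define f where "f = (\<lambda>z. N 1 z / N 0 z)"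
  have f_hol: "f holomorphic_on D"
    unfolding f_def using D(3) holD by (intro holomorphic_intros)
  have real_D: "\<theta> \<in> {-\<epsilon><..<\<epsilon>}" if "complex_of_real \<theta> \<in> D" for \<theta>
    using that by (auto simp: D_def)
  have f_real: "f (of_real \<theta>) = of_real (cs_mean \<nu> \<theta>)" if "complex_of_real \<theta> \<in> D" for \<theta>
    using cs_mean_eq[OF real_distribution_\<nu> radius real_D[OF that]]
    by (simp add: f_def N_real cs_M_def)

  \<comment> \<open>\<open>m'(0)\<close> is the variance of \<open>\<nu>\<close>: divide out \<open>z\<close> in \<open>m(z) = m0 + z W(z)\<close>.\<close>
  define W where "W = (\<lambda>z. (N 2 z - of_real m0 * N 1 z) / N 0 z)"
  \<comment> \<open>Index shift: coefficient \<open>Suc n\<close> of \<open>N k\<close> is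
    coefficient \<open>n\<close> of \<open>N (Suc k)\<close>.\<close>
  have shift: "N k z = N k 0 + z * N (Suc k) z" if "z \<in> D" for k z
  proof -
    have zK: "norm z * K < 1" using that K(1) by (auto simp: D_def field_simps)
    have "(\<lambda>n. (LINT x|\<nu>. of_real x ^ k * of_real x ^ n) * z ^ n) sums N k z"
      unfolding N_def
    proof (rule geometric_kernel_sums)
      show "AE x in \<nu>. norm (complex_of_real x ^ k) \<le> K ^ k"
        using K(2) by eventually_elim (simp add: norm_power power_mono)
    qed (use K zK in auto)
    then have 1: "(\<lambda>n. (LINT x|\<nu>. of_real x ^ k * of_real x ^ Suc n) * z ^ Suc n) sums (N k z - N k 0)"
      by (subst sums_Suc_iff) (simp add: N_def)
    have "(\<lambda>n. (LINT x|\<nu>. of_real x ^ Suc k * of_real x ^ n) * z ^ n) sums N (Suc k) z"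
      unfolding N_def
    proof (rule geometric_kernel_sums)
      show "AE x in \<nu>. norm (complex_of_real x ^ Suc k) \<le> K ^ Suc k"
        using K(2) by eventually_elim (simp only: norm_power norm_of_real power_mono abs_ge_zero)
    qed (use K zK in auto)
    from sums_mult[OF this, of z]
    have "(\<lambda>n. (LINT x|\<nu>. of_real x ^ k * of_real x ^ Suc n) * z ^ Suc n) sums (z * N (Suc k) z)"
      by (simp add: mult_ac)
    with 1 have "N k z - N k 0 = z * N (Suc k) z" by (rule sums_unique2)
    then show ?thesis by (simp add: algebra_simps)
  qed
  have N1_0: "N 1 0 = of_real m0" using N0[of 1] mean by simp
  have fW: "f z = of_real m0 + z * W z" if "z \<in> D" for z
  proof -
    have "N 1 z = of_real m0 + z * N 2 z" "N 0 z = 1 + z * N 1 z"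
      using shift[OF that, of 1] shift[OF that, of 0] N1_0 N_0 by (simp_all add: numeral_2_eq_2)
    then have "N 1 z = of_real m0 * N 0 z + z * (N 2 z - of_real m0 * N 1 z)"
      by (simp add: algebra_simps)
    then show ?thesis using D(3)[OF that] by (simp add: f_def W_def field_simps)
  qed
  have W_hol: "W holomorphic_on D"
    unfolding W_def using D(3) holD by (intro holomorphic_intros)
  have W0: "W 0 = of_real (cs_variance \<nu> \<epsilon> m0)"
    using variance_eq[OF zero_in_range mean_zero [symmetric]] N0[of 2] N1_0 N_0 prob_space
    by (simp add: W_def cs_second_def cs_M_def power2_eq_square)
  have "W 0 \<noteq> 0"
    using variance_pos[OF zero_in_range mean_zero [symmetric]] by (simp add: W0)
  \<comment> \<open>In the product rule for \<open>z * W z\<close> the term with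
    \<open>deriv W 0\<close> carries the factor \<open>z = 0\<close>.\<close>
  moreover have "(f has_field_derivative W 0) (at 0)"
  proof (rule has_field_derivative_transform_within_open)
    have "(W has_field_derivative deriv W 0) (at 0)"
      using W_hol D by (intro holomorphic_derivI)
    from DERIV_add[OF DERIV_const[of "of_real m0"] DERIV_mult[OF DERIV_ident this]]
    show "((\<lambda>z. of_real m0 + z * W z) has_field_derivative W 0) (at 0)"
      by simp
  qed (use D fW in auto)
  ultimately have "deriv f 0 \<noteq> 0" by (simp add: DERIV_imp_deriv)
  then obtain r where r: "r > 0" "ball 0 r \<subseteq> D" "inj_on f (ball 0 r)"
    using has_complex_derivative_locally_injective[OF f_hol D(2,1)] by blast
  have f_hol_r: "f holomorphic_on ball 0 r"
    using f_hol r(2) by (rule holomorphic_on_subset)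
  obtain g where g: "g holomorphic_on f ` ball 0 r" "\<And>z. z \<in> ball 0 r \<Longrightarrow> g (f z) = z"
    using holomorphic_has_inverse[OF f_hol_r open_ball r(3)] by blast
  have "open (f ` ball 0 r)"
    by (rule open_mapping_thm3[OF f_hol_r open_ball r(3)])

  \<comment> \<open>Halving places the closed interval \<open>{-s..s}\<close>, needed for the
    intermediate value theorem, inside the open ball.\<close>
  define s where "s = r / 2"
  have s: "0 < s" "s < r" using r(1) by (auto simp: s_def)
  have in_r: "complex_of_real \<theta> \<in> ball 0 r" if "\<theta> \<in> {-s..s}" for \<theta>
    using that s by auto
  have in_\<epsilon>: "\<theta> \<in> {-\<epsilon><..<\<epsilon>}" if "\<theta> \<in> {-s..s}" for \<theta>
    using in_r[OF that] r(2) real_D by blast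
  have f_mean: "f (of_real \<theta>) = of_real (cs_mean \<nu> \<theta>)" if "\<theta> \<in> {-s..s}" for \<theta>
    using in_r[OF that] r(2) by (intro f_real) blast
  \<comment> \<open>Continuity of the real mean is inherited from its holomorphic extension
    \<open>f\<close>.\<close>
  have "continuous_on {-s..s} (\<lambda>\<theta>. Re (f (of_real \<theta>)))"
    by (intro continuous_intros continuous_on_compose2[OF holomorphic_on_imp_continuous_on[OF f_hol_r]])
      (use in_r in auto)
  then have cont: "continuous_on {-s..s} (cs_mean \<nu>)"
    by (rule continuous_on_eq) (simp only: f_mean Re_complex_of_real)
  define A where "A = cs_mean \<nu> (- s)"
  define B where "B = cs_mean \<nu> s"
  have mono: "strict_mono_on {-\<epsilon><..<\<epsilon>} (cs_mean \<nu>)"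
    by (rule strict_mono_on_cs_mean[OF real_distribution_\<nu> compact_supp nondeg radius])
  have AB: "A < m0" "m0 < B"
    using strict_mono_onD[OF mono, of "- s" 0] strict_mono_onD[OF mono, of 0 s] in_\<epsilon> s
    by (auto simp: A_def B_def mean_zero)
  have ivt: "\<exists>\<theta>\<in>{-s..s}. cs_mean \<nu> \<theta> = m" if "m \<in> {A<..<B}" for m
    using IVT'[of "cs_mean \<nu>" "- s" m s] that s cont by (auto simp: A_def B_def)
  have "real_analytic_on (cs_variance \<nu> \<epsilon>) {A<..<B}"
  proof (rule real_analytic_on_holomorphic)
    have g_D: "g ` f ` ball 0 r \<subseteq> D" using g(2) r(2) by auto
    show "(\<lambda>w. N 2 (g w) / N 0 (g w) - w\<^sup>2) holomorphic_on f ` ball 0 r"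
      using D(3) g_D
      by (intro holomorphic_intros holomorphic_on_compose_gen[OF g(1) holD, unfolded o_def]) auto
    fix m assume "m \<in> {A<..<B}"
    then obtain \<theta> where \<theta>: "\<theta> \<in> {-s..s}" "m = cs_mean \<nu> \<theta>" using ivt by blast
    have fm: "of_real m = f (of_real \<theta>)"
      using f_mean[OF \<theta>(1)] \<theta>(2) by simp
    then show "of_real m \<in> f ` ball 0 r \<and>
        N 2 (g (of_real m)) / N 0 (g (of_real m)) - (of_real m)\<^sup>2 = of_real (cs_variance \<nu> \<epsilon> m)"
      using g(2)[OF in_r[OF \<theta>(1)]] in_r[OF \<theta>(1)] variance_eq[OF in_\<epsilon>[OF \<theta>(1)] \<theta>(2)]
      by (simp add: N_real cs_second_def cs_M_def)
  qed (use \<open>open (f ` ball 0 r)\<close> in auto)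
  moreover have "{A<..<B} \<subseteq> cs_mean \<nu> ` {-\<epsilon><..<\<epsilon>}"
    using ivt in_\<epsilon> by blast
  ultimately show ?thesis using AB that by blast
qed

end

section \<open>Measures with a prescribed variance function\<close>

text \<open>The support is closed, its complement being a union of null open sets, and the
  complement of the interval is itself such a set.\<close>

lemma compactly_supported_AE_Icc:
  assumes "real_distribution \<nu>" "AE x in \<nu>. x \<in> {l..u}"
  shows "compactly_supported \<nu>"
proof -
  interpret real_distribution \<nu> by fact
  have "- msupport \<nu> = \<Union>{U. open U \<and> emeasure \<nu> U = 0}"
    by (auto simp: msupport_def)
  then have "closed (msupport \<nu>)"
    unfolding closed_def by (auto intro!: open_Union)
  moreover have "msupport \<nu> \<subseteq> {l..u}"
  proof
    fix x assume x: "x \<in> msupport \<nu>"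
    show "x \<in> {l..u}"
    proof (rule ccontr)
      assume "x \<notin> {l..u}"
      then have "open (- {l..u})" "x \<in> - {l..u}" by auto
      then have "emeasure \<nu> (- {l..u}) > 0"
        using x unfolding msupport_def by blast
      moreover have "emeasure \<nu> (- {l..u}) = 0"
        using assms(2) by (subst (asm) AE_iff_measurable[OF _ refl]) (auto simp: Compl_eq)
      ultimately show False by simp
    qed
  qed
  ultimately show ?thesis
    unfolding compactly_supported_def compact_eq_bounded_closed
    using bounded_closed_interval bounded_subset by blast
qed

locale cs_prescribed = real_distribution \<nu> for \<nu> +
  fixes m0 :: real and V :: "real \<Rightarrow> real"
  assumes mean: "(LINT x|\<nu>. x) = m0"
    and cont: "isCont V m0" and pos: "V m0 > 0"
    and Q: "\<forall>\<^sub>F m in nhds m0. cs_Q_prob \<nu> m0 V m"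
begin

lemma real_distribution_\<nu>: "real_distribution \<nu>" ..

lemma V_pos: "\<forall>\<^sub>F m in nhds m0. V m > 0"
  using order_tendstoD(1)[OF cont[unfolded isCont_def] pos] pos
  by (simp add: eventually_nhds_conv_at)

lemma good: "\<forall>\<^sub>F m in nhds m0. V m > 0 \<and> cs_Q_prob \<nu> m0 V m"
  using V_pos Q by (rule eventually_conj)

text \<open>Almost sure positivity of the denominator excludes truncation by \<open>ennreal\<close>,
  so total mass one becomes a statement about a real integral.\<close>

lemma integral_Q:
  assumes "V m > 0" "cs_Q_prob \<nu> m0 V m"
  shows "(LINT x|\<nu>. V m / (V m + (m - m0) * (m - x))) = 1"
proof -
  let ?f = "\<lambda>x. V m / (V m + (m - m0) * (m - x))"
  have nn: "AE x in \<nu>. 0 \<le> ?f x"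
    using assms by (auto simp: cs_Q_prob_def elim!: eventually_mono)
  have "emeasure (cs_Q \<nu> m0 V m) UNIV = 1"
    using assms(2) prob_space.emeasure_space_1[of "cs_Q \<nu> m0 V m"]
    by (simp add: cs_Q_prob_def cs_Q_def)
  then have "(\<integral>\<^sup>+ x. ennreal (?f x) \<partial>\<nu>) = 1"
    by (simp add: cs_Q_def emeasure_density)
  then show ?thesis
    using integral_eq_nn_integral[OF _ nn] by simp
qed

lemma compactly_supported: "compactly_supported \<nu>"
proof -
  obtain r where "r > 0" and r: "\<And>m. dist m m0 < r \<Longrightarrow> cs_Q_prob \<nu> m0 V m"
    using Q unfolding eventually_nhds_metric by blast
  \<comment> \<open>The sign of \<open>m - m0\<close> decides which side positivity bounds:
    \<open>p\<close> bounds \<open>x\<close> from above, \<open>q\<close> from below.\<close>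
  define p where "p = m0 + r / 2"
  define q where "q = m0 - r / 2"
  have "AE x in \<nu>. V p + (p - m0) * (p - x) > 0" "AE x in \<nu>. V q + (q - m0) * (q - x) > 0"
    using r[of p] r[of q] \<open>r > 0\<close> by (auto simp: cs_Q_prob_def p_def q_def dist_real_def)
  then have "AE x in \<nu>. x \<in> {q - V q / (r / 2)..p + V p / (r / 2)}"
    by eventually_elim (use \<open>r > 0\<close> in \<open>auto simp: p_def q_def field_simps\<close>)
  then show ?thesis by (rule compactly_supported_AE_Icc[OF real_distribution_\<nu>])
qed

text \<open>A point mass would sit at \<open>m0\<close>, and normalisation of \<open>cs_Q\<close>
  would give \<open>V m / (V m + (m - m0)\<^sup>2) = 1\<close> for some
  \<open>m \<noteq> m0\<close>.\<close>

lemma non_degenerate: "non_degenerate \<nu>"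
  unfolding non_degenerate_def
proof (intro allI notI)
  fix c assume c: "\<nu> = return borel c"
  then have "c = m0" using mean by (simp add: integral_return)
  obtain r where "r > 0" and r: "\<And>m. dist m m0 < r \<Longrightarrow> V m > 0 \<and> cs_Q_prob \<nu> m0 V m"
    using good unfolding eventually_nhds_metric by blast
  define m where "m = m0 + r / 2"
  have m: "V m > 0" "cs_Q_prob \<nu> m0 V m"
    using r[of m] \<open>r > 0\<close> by (auto simp: m_def dist_real_def)
  have "V m / (V m + (m - m0) * (m - m0)) = 1"
    using integral_Q[OF m] unfolding c \<open>c = m0\<close> by (subst (asm) integral_return) auto
  then have "(m - m0) * (m - m0) = 0" by (auto simp: divide_eq_1_iff)
  then show False using \<open>r > 0\<close> by (simp add: m_def)
qed

text \<open>At this \<open>z\<close> the kernel \<open>1 / (z - x)\<close> is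
  \<open>(m - m0) / V m\<close> times the density of \<open>cs_Q\<close>, whose integral is
  1.\<close>

lemma cauchy_stieltjes_eq:
  "\<forall>\<^sub>F m in at m0. cauchy_stieltjes \<nu> (complex_of_real (m + V m / (m - m0))) =
    complex_of_real ((m - m0) / V m)"
  unfolding eventually_at_filter
  using good
proof eventually_elim
  case (elim m)
  show ?case
  proof (intro impI)
    assume "m \<noteq> m0"
    define z where "z = m + V m / (m - m0)"
    have "cauchy_stieltjes \<nu> (of_real z) = of_real (LINT x|\<nu>. 1 / (z - x))"
      unfolding cauchy_stieltjes_def by (simp flip: integral_complex_of_real)
    also have "(LINT x|\<nu>. 1 / (z - x)) =
        (LINT x|\<nu>. (m - m0) / V m * (V m / (V m + (m - m0) * (m - x))))"
    \<comment> \<open>The identity is pointwise; at \<open>x = z\<close> both sides are 0 by the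
      convention for division.\<close>
    proof (rule Bochner_Integration.integral_cong)
      fix x
      have "z - x = (V m + (m - m0) * (m - x)) / (m - m0)"
        using \<open>m \<noteq> m0\<close> by (simp add: z_def field_simps)
      then show "1 / (z - x) = (m - m0) / V m * (V m / (V m + (m - m0) * (m - x)))"
        using elim by simp
    qed simp
    also have "\<dots> = (m - m0) / V m"
      unfolding integral_mult_right_zero using integral_Q elim by simp
    finally show "cauchy_stieltjes \<nu> (complex_of_real (m + V m / (m - m0))) =
        complex_of_real ((m - m0) / V m)"
      by (simp only: z_def)
  qed
qed

section \<open>Identification with the family generated by \<open>\<nu>\<close>\<close>

text \<open>Candidate for the inverse of the mean: \<open>theta_variance\<close> solved for the
  parameter, with \<open>V\<close> in place of the variance function. At \<open>m0\<close> it is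
  0.\<close>

definition theta :: "real \<Rightarrow> real" where
  "theta m = (m - m0) / (V m + m * (m - m0))"

lemma cs_family_radius: "cs_radius \<nu> \<epsilon> \<Longrightarrow> cs_family \<nu> \<epsilon> m0"
  using compactly_supported non_degenerate mean
  by (intro cs_family.intro cs_family_axioms.intro real_distribution_\<nu>)

text \<open>The denominator of \<open>cs_Q\<close> factors as \<open>D * (1 - theta m * x)\<close>,
  so normalisation yields \<open>cs_M \<nu> (theta m) = D / V m\<close> and equality of the
  densities; \<open>M_eq\<close> then returns the mean.\<close>

lemma near_mean:
  assumes \<epsilon>: "cs_radius \<nu> \<epsilon>"
  shows "\<forall>\<^sub>F m in nhds m0. V m + m * (m - m0) > 0 \<and> theta m \<in> {-\<epsilon><..<\<epsilon>} \<and>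
    cs_mean \<nu> (theta m) = m \<and> cs_Q \<nu> m0 V m = cs_P \<nu> (theta m)"
proof -
  interpret cs_family \<nu> \<epsilon> m0 using \<epsilon> by (rule cs_family_radius)
  \<comment> \<open>The filter is \<open>nhds m0\<close> rather than \<open>at m0\<close>, so that
    the conclusions cover \<open>m = m0\<close> too.\<close>
  have D_lim: "((\<lambda>m. V m + m * (m - m0)) \<longlongrightarrow> V m0) (nhds m0)"
    using cont by (auto intro!: tendsto_eq_intros simp: isCont_def tendsto_nhds_iff)
  have "((\<lambda>m. (m - m0) / (V m + m * (m - m0))) \<longlongrightarrow> (m0 - m0) / V m0) (nhds m0)"
    by (intro tendsto_divide tendsto_diff D_lim tendsto_const filterlim_ident) (use pos in simp)
  then have "(theta \<longlongrightarrow> 0) (nhds m0)"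
    by (simp add: theta_def [abs_def])
  then have "\<forall>\<^sub>F m in nhds m0. theta m \<in> {-\<epsilon><..<\<epsilon>}"
    using zero_in_range by (intro topological_tendstoD) auto
  moreover have "\<forall>\<^sub>F m in nhds m0. V m + m * (m - m0) > 0"
    using D_lim pos by (rule order_tendstoD)
  ultimately show ?thesis using good
  proof eventually_elim
    case (elim m)
    define D where "D = V m + m * (m - m0)"
    have D: "D > 0" using elim by (simp add: D_def)
    have D_theta: "D * theta m = m - m0"
      using D by (simp add: theta_def D_def [symmetric])
    have denom: "V m + (m - m0) * (m - x) = D * (1 - theta m * x)" for x
    proof -
      have "V m + (m - m0) * (m - x) = D - (m - m0) * x"
        by (simp add: D_def algebra_simps)
      then show ?thesis by (simp add: right_diff_distrib D_theta flip: mult.assoc)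
    qed
    have "1 = (LINT x|\<nu>. V m / D * (1 / (1 - theta m * x)))"
      using integral_Q[of m] elim by (simp add: denom)
    also have "\<dots> = V m / D * cs_M \<nu> (theta m)"
      unfolding cs_M_def by (rule integral_mult_right_zero)
    finally have M: "cs_M \<nu> (theta m) = D / V m"
      using D elim by (simp add: field_simps)
    have Q_eq: "cs_Q \<nu> m0 V m = cs_P \<nu> (theta m)"
      unfolding cs_Q_def cs_P_def denom M by simp
    have "cs_mean \<nu> (theta m) = m"
    \<comment> \<open>For \<open>m = m0\<close> the parameter vanishes and \<open>M_eq\<close>
      carries no information on the mean.\<close>
    proof (cases "m = m0")
      case True
      then show ?thesis using mean_zero by (simp add: theta_def)
    next
      case False
      then have "theta m \<noteq> 0" using D by (simp add: theta_def D_def)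
      have "theta m * (cs_mean \<nu> (theta m) * (D / V m)) = D / V m - 1"
        using M_eq[OF elim(1)] unfolding M by linarith
      also have "\<dots> = m * (m - m0) / V m"
        using elim by (simp add: D_def field_simps)
      also have "\<dots> = theta m * (m * (D / V m))"
        using D elim by (simp add: theta_def D_def [symmetric])
      finally show ?thesis using \<open>theta m \<noteq> 0\<close> D elim by simp
    qed
    with Q_eq elim show ?case by simp
  qed
qed

lemma psi_eq:
  assumes \<epsilon>: "cs_radius \<nu> \<epsilon>"
  shows "\<forall>\<^sub>F m in at m0. 1 / cs_psi \<nu> \<epsilon> m = m + V m / (m - m0)"
proof -
  interpret cs_family \<nu> \<epsilon> m0 using \<epsilon> by (rule cs_family_radius)
  show ?thesis
    unfolding eventually_at_filter
    using near_mean[OF \<epsilon>]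
  proof eventually_elim
    case (elim m)
    then have "cs_psi \<nu> \<epsilon> m = theta m" using psi_mean[of "theta m"] by simp
    then show ?case by (simp add: theta_def add_divide_distrib)
  qed
qed

lemma cs_Q_eq_cs_P_near_mean:
  assumes \<epsilon>: "cs_radius \<nu> \<epsilon>"
  shows "\<exists>R. open R \<and> m0 \<in> R \<and> R \<subseteq> cs_mean \<nu> ` {-\<epsilon><..<\<epsilon>} \<and>
    (\<forall>m\<in>R. cs_Q \<nu> m0 V m = cs_P \<nu> (cs_psi \<nu> \<epsilon> m))"
proof -
  interpret cs_family \<nu> \<epsilon> m0 using \<epsilon> by (rule cs_family_radius)
  obtain R where R: "open R" "m0 \<in> R" "\<And>m. m \<in> R \<Longrightarrow> theta m \<in> {-\<epsilon><..<\<epsilon>} \<and>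
      cs_mean \<nu> (theta m) = m \<and> cs_Q \<nu> m0 V m = cs_P \<nu> (theta m)"
    using near_mean[OF \<epsilon>] unfolding eventually_nhds by blast
  have "cs_Q \<nu> m0 V m = cs_P \<nu> (cs_psi \<nu> \<epsilon> m)" if "m \<in> R" for m
    using R(3)[OF that] psi_mean[of "theta m"] by simp
  moreover have "R \<subseteq> cs_mean \<nu> ` {-\<epsilon><..<\<epsilon>}"
    using R(3) by (metis image_eqI subsetI)
  ultimately show ?thesis using R(1,2) by blast
qed

end

text \<open>Both parts hold for every admissible radius, and inclusion in the image of the parameter
  interval makes \<open>cs_psi\<close> meaningful. Integrability is stated next to the mean because
  the integral of a non-integrable function is 0 by default.\<close>

theorem theorem3p1:
  shows
    "(\<forall>(\<nu> :: real measure) (m0 :: real) (\<epsilon> :: real).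
        real_distribution \<nu> \<and> non_degenerate \<nu> \<and> compactly_supported \<nu> \<and>
        (LINT x|\<nu>. x) = m0 \<and> cs_radius \<nu> \<epsilon> \<longrightarrow>
        (\<exists>A B. A < m0 \<and> m0 < B \<and>
           {A<..<B} \<subseteq> cs_mean \<nu> ` {-\<epsilon><..<\<epsilon>} \<and>
           real_analytic_on (cs_variance \<nu> \<epsilon>) {A<..<B} \<and>
           (\<forall>m\<in>{A<..<B}. cs_variance \<nu> \<epsilon> m > 0 \<and>
              cs_P \<nu> (cs_psi \<nu> \<epsilon> m) = cs_Q \<nu> m0 (cs_variance \<nu> \<epsilon>) m)))
     \<and>
     (\<forall>(m0 :: real) (V :: real \<Rightarrow> real) (\<nu> :: real measure).
        (\<exists>N. open N \<and> m0 \<in> N \<and> real_analytic_on V N \<and> (\<forall>m\<in>N. V m > 0)) \<and>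
        real_distribution \<nu> \<and> integrable \<nu> (\<lambda>x. x) \<and> (LINT x|\<nu>. x) = m0 \<and>
        (\<forall>\<^sub>F m in nhds m0. cs_Q_prob \<nu> m0 V m) \<longrightarrow>
        compactly_supported \<nu> \<and> non_degenerate \<nu> \<and>
        (\<forall>\<nu>'. real_distribution \<nu>' \<and>
            (\<forall>\<^sub>F z in at_infinity. Im z \<noteq> 0 \<longrightarrow> cauchy_stieltjes \<nu>' z = cauchy_stieltjes \<nu> z)
            \<longrightarrow> \<nu>' = \<nu>) \<and>
        (\<forall>\<^sub>F m in at m0.
           cauchy_stieltjes \<nu> (complex_of_real (m + V m / (m - m0))) =
             complex_of_real ((m - m0) / V m)) \<and>
        (\<forall>\<epsilon>. cs_radius \<nu> \<epsilon> \<longrightarrow>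
           (\<forall>\<^sub>F m in at m0. 1 / cs_psi \<nu> \<epsilon> m = m + V m / (m - m0)) \<and>
           (\<exists>R. open R \<and> m0 \<in> R \<and> R \<subseteq> cs_mean \<nu> ` {-\<epsilon><..<\<epsilon>} \<and>
              (\<forall>m\<in>R. cs_Q \<nu> m0 V m = cs_P \<nu> (cs_psi \<nu> \<epsilon> m)))))"
proof (intro conjI allI impI; elim conjE exE)
  fix \<nu> m0 \<epsilon>
  assume "real_distribution \<nu>" "non_degenerate \<nu>" "compactly_supported \<nu>"
    "(LINT x|\<nu>. x) = m0" "cs_radius \<nu> \<epsilon>"
  then interpret cs_family \<nu> \<epsilon> m0
    by (intro cs_family.intro cs_family_axioms.intro)
  obtain A B where AB: "A < m0" "m0 < B" "{A<..<B} \<subseteq> cs_mean \<nu> ` {-\<epsilon><..<\<epsilon>}"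
    "real_analytic_on (cs_variance \<nu> \<epsilon>) {A<..<B}"
    by (rule variance_analytic_near_mean)
  have "cs_variance \<nu> \<epsilon> m > 0 \<and> cs_P \<nu> (cs_psi \<nu> \<epsilon> m) = cs_Q \<nu> m0 (cs_variance \<nu> \<epsilon>) m"
    if m: "m \<in> {A<..<B}" for m
  proof -
    obtain \<theta> where \<theta>: "\<theta> \<in> {-\<epsilon><..<\<epsilon>}" "m = cs_mean \<nu> \<theta>" using m AB(3) by blast
    then show ?thesis
      using variance_pos[OF \<theta>] cs_P_eq_cs_Q[OF \<theta>] psi_mean[OF \<theta>(1)] by simp
  qed
  with AB show "\<exists>A B. A < m0 \<and> m0 < B \<and> {A<..<B} \<subseteq> cs_mean \<nu> ` {-\<epsilon><..<\<epsilon>} \<and>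
      real_analytic_on (cs_variance \<nu> \<epsilon>) {A<..<B} \<and>
      (\<forall>m\<in>{A<..<B}. cs_variance \<nu> \<epsilon> m > 0 \<and>
        cs_P \<nu> (cs_psi \<nu> \<epsilon> m) = cs_Q \<nu> m0 (cs_variance \<nu> \<epsilon>) m)"
    by blast
next
  fix m0 V \<nu> N
  assume N: "m0 \<in> N" "real_analytic_on V N" "\<forall>m\<in>N. V m > 0"
    and \<nu>: "real_distribution \<nu>" "(LINT x|\<nu>. x) = m0" "\<forall>\<^sub>F m in nhds m0. cs_Q_prob \<nu> m0 V m"
  interpret cs_prescribed \<nu> m0 V
    using N \<nu> real_analytic_on_isCont[OF N(2,1)]
    by (intro cs_prescribed.intro cs_prescribed_axioms.intro) auto
  show "compactly_supported \<nu>" by (rule compactly_supported)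
  show "non_degenerate \<nu>" by (rule non_degenerate)
  show "\<nu>' = \<nu>" if "real_distribution \<nu>'"
    "\<forall>\<^sub>F z in at_infinity. Im z \<noteq> 0 \<longrightarrow> cauchy_stieltjes \<nu>' z = cauchy_stieltjes \<nu> z" for \<nu>'
    using cauchy_stieltjes_unique[OF that(1) \<nu>(1) that(2)] .
  show "\<forall>\<^sub>F m in at m0. cauchy_stieltjes \<nu> (complex_of_real (m + V m / (m - m0))) =
      complex_of_real ((m - m0) / V m)"
    by (rule cauchy_stieltjes_eq)
  fix \<epsilon> assume "cs_radius \<nu> \<epsilon>"
  then show "\<forall>\<^sub>F m in at m0. 1 / cs_psi \<nu> \<epsilon> m = m + V m / (m - m0)"
    "\<exists>R. open R \<and> m0 \<in> R \<and> R \<subseteq> cs_mean \<nu> ` {-\<epsilon><..<\<epsilon>} \<and>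
      (\<forall>m\<in>R. cs_Q \<nu> m0 V m = cs_P \<nu> (cs_psi \<nu> \<epsilon> m))"
    by (rule psi_eq cs_Q_eq_cs_P_near_mean)+
qed

end
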